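(* $\mathbf{JID_1}=\mathbf{DSt}\vee\mathbf{V(D_1,D_2,D_3)}$, where the join is taken in the lattice of subvarieties of $\mathbf{DQD}$ and $\mathbf{V(D_1,D_2,D_3)}$ is the variety generated by $\{\mathbf{D_1},\mathbf{D_2},\mathbf{D_3}\}$.
   Context: A semi-Heyting algebra is an algebra $\langle L,\vee,\wedge,\to,0,1\rangle$ such that $\langle L,\vee,\wedge,0,1\rangle$ is a bounded lattice and the identities $x\wedge(x\to y)\approx x\wedge y$, $x\wedge(y\to z)\approx x\wedge[(x\wedge y)\to(x\wedge z)]$, $x\to x\approx 1$ hold; write $x^*:=x\to 0$. A $\mathbf{DQD}$-algebra (dually quasi-De Morgan semi-Heyting algebra) is an algebra $\langle L,\vee,\wedge,\to,{}',0,1\rangle$ whose reduct $\langle L,\vee,\wedge,\to,0,1\rangle$ is a semi-Heyting algebra and which satisfies: $0'\approx 1$ and $1'\approx 0$; $(x\wedge y)'\approx x'\vee y'$; $(x\vee y)''\approx x''\vee y''$; $x''\le x$. $\mathbf{DQD}$ denotes the variety of all $\mathbf{DQD}$-algebras. $\mathbf{DSt}$ is the subvariety of $\mathbf{DQD}$ defined by $x'\wedge x''\approx 0$. $\mathbf{JID}$ is the subvariety of $\mathbf{DQD}$ defined by $x'\vee(y\to z)\approx(x'\vee y)\to(x'\vee z)$, and $\mathbf{JID_1}$ is the subvariety of $\mathbf{JID}$ defined by $x\wedge x'^{*}\approx (x\wedge x'^{*})'^{*}$ (where $z'^*$ means $(z')^*$); relative to $\mathbf{JID}$ this is equivalent to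 the level-1 identity $x\wedge x'^*\approx x\wedge x'^*\wedge x'^*{}'^*$. The algebras $\mathbf{D_1},\mathbf{D_2},\mathbf{D_3}$ all have universe $\{0,a,b,1\}$ with the four-element Boolean lattice order ($a,b$ complementary atoms), and $0'=1$, $1'=0$, $a'=a$, $b'=b$. The operation $\to$ is given by listing, for each $x$, the tuple $(x\to 0,\ x\to 1,\ x\to a,\ x\to b)$. In $\mathbf{D_1}$: $x=0$: $(1,0,b,a)$; $x=1$: $(0,1,a,b)$; $x=a$: $(b,a,1,0)$; $x=b$: $(a,b,0,1)$. In $\mathbf{D_2}$: $x=0$: $(1,1,1,1)$; $x=1$: $(0,1,a,b)$; $x=a$: $(b,1,1,b)$; $x=b$: $(a,1,a,1)$. In $\mathbf{D_3}$: $x=0$: $(1,a,1,a)$; $x=1$: $(0,1,a,b)$; $x=a$: $(b,a,1,0)$; $x=b$: $(a,1,a,1)$. *)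

theory Defs
  imports Main
begin

record 'a alg =
  carr :: "'a set"
  jn :: "'a \<Rightarrow> 'a \<Rightarrow> 'a"
  mt :: "'a \<Rightarrow> 'a \<Rightarrow> 'a"
  im :: "'a \<Rightarrow> 'a \<Rightarrow> 'a"
  ng :: "'a \<Rightarrow> 'a"
  zr :: 'a
  on :: 'a

definition is_alg :: "'a alg \<Rightarrow> bool" where
  "is_alg A \<longleftrightarrow>
     zr A \<in> carr A \<and> on A \<in> carr A \<and>
     (\<forall>x\<in>carr A. ng A x \<in> carr A) \<and>
     (\<forall>x\<in>carr A. \<forall>y\<in>carr A. jn A x y \<in> carr A \<and> mt A x y \<in> carr A \<and> im A x y \<in> carr A)"

definition isomorphic :: "'a alg \<Rightarrow> 'b alg \<Rightarrow> bool" where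
  "isomorphic A B \<longleftrightarrow> is_alg A \<and> is_alg B \<and>
     (\<exists>f. bij_betw f (carr A) (carr B) \<and>
        f (zr A) = zr B \<and> f (on A) = on B \<and>
        (\<forall>x\<in>carr A. f (ng A x) = ng B (f x)) \<and>
        (\<forall>x\<in>carr A. \<forall>y\<in>carr A.
           f (jn A x y) = jn B (f x) (f y) \<and>
           f (mt A x y) = mt B (f x) (f y) \<and>
           f (im A x y) = im B (f x) (f y)))"


section \<open>Terms, identities and varieties\<close>

datatype trm =
    Var nat
  | Zero
  | One
  | Neg trm  ("_\<^sup>\<sim>" [1000] 1000)
  | Meet trm trm  (infixl "\<curlywedge>" 70)
  | Join trm trm  (infixl "\<curlyvee>" 65)
  | Imp trm trm  (infixr "\<rightharpoonup>" 60)

abbreviation Star :: "trm \<Rightarrow> trm"  ("_\<^sup>\<star>" [1000] 1000) where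
  "t\<^sup>\<star> \<equiv> t \<rightharpoonup> Zero"

datatype identity = Eq trm trm  (infix "\<approx>" 50)

primrec eval :: "'a alg \<Rightarrow> (nat \<Rightarrow> 'a) \<Rightarrow> trm \<Rightarrow> 'a" where
  "eval A v (Var i) = v i"
| "eval A v Zero = zr A"
| "eval A v One = on A"
| "eval A v (t\<^sup>\<sim>) = ng A (eval A v t)"
| "eval A v (s \<curlywedge> t) = mt A (eval A v s) (eval A v t)"
| "eval A v (s \<curlyvee> t) = jn A (eval A v s) (eval A v t)"
| "eval A v (s \<rightharpoonup> t) = im A (eval A v s) (eval A v t)"

primrec holds :: "'a alg \<Rightarrow> identity \<Rightarrow> bool" where
  "holds A (s \<approx> t) \<longleftrightarrow> (\<forall>v. range v \<subseteq> carr A \<longrightarrow> eval A v s = eval A v t)"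

definition Mod :: "identity set \<Rightarrow> 'a alg set" where
  "Mod E = {A. is_alg A \<and> (\<forall>e\<in>E. holds A e)}"

text \<open>A variety is represented by its members whose universe is a subset of the type \<open>'a\<close>.
  When \<open>'a\<close> is infinite this loses nothing: a variety is determined by its finitely generated
  members, which are countable, so this representation preserves and reflects inclusion of
  varieties.\<close>

definition variety :: "'a alg set \<Rightarrow> bool" where
  "variety V \<longleftrightarrow> (\<exists>E. V = Mod E)"

definition generated_variety :: "'a alg set \<Rightarrow> 'a alg set" where
  "generated_variety K = \<Inter>{V. variety V \<and> K \<subseteq> V}"

definition subvarieties :: "'a alg set \<Rightarrow> 'a alg set set" where
  "subvarieties W = {V. variety V \<and> V \<subseteq> W}"

definition join_in :: "'a alg set \<Rightarrow> 'a alg set \<Rightarrow> 'a alg set \<Rightarrow> 'a alg set" where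
  "join_in W U V = \<Inter>{X \<in> subvarieties W. U \<subseteq> X \<and> V \<subseteq> X}"


section \<open>The varieties of the theorem\<close>

abbreviation "vx \<equiv> Var 0"
abbreviation "vy \<equiv> Var 1"
abbreviation "vz \<equiv> Var 2"

definition bounded_lattice_ids :: "identity set" where
  "bounded_lattice_ids = {
     vx \<curlyvee> vy \<approx> vy \<curlyvee> vx,
     vx \<curlywedge> vy \<approx> vy \<curlywedge> vx,
     vx \<curlyvee> (vy \<curlyvee> vz) \<approx> (vx \<curlyvee> vy) \<curlyvee> vz,
     vx \<curlywedge> (vy \<curlywedge> vz) \<approx> (vx \<curlywedge> vy) \<curlywedge> vz,
     vx \<curlyvee> vx \<approx> vx,
     vx \<curlywedge> vx \<approx> vx,
     vx \<approx> vx \<curlyvee> (vx \<curlywedge> vy),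
     vx \<approx> vx \<curlywedge> (vx \<curlyvee> vy),
     vx \<curlywedge> Zero \<approx> Zero,
     vx \<curlyvee> One \<approx> One}"

definition semi_Heyting_ids :: "identity set" where
  "semi_Heyting_ids = bounded_lattice_ids \<union> {
     vx \<curlywedge> (vx \<rightharpoonup> vy) \<approx> vx \<curlywedge> vy,
     vx \<curlywedge> (vy \<rightharpoonup> vz) \<approx> vx \<curlywedge> ((vx \<curlywedge> vy) \<rightharpoonup> (vx \<curlywedge> vz)),
     vx \<rightharpoonup> vx \<approx> One}"

text \<open>The last identity says \<open>x'' \<le> x\<close>.\<close>

definition DQD_ids :: "identity set" where
  "DQD_ids = semi_Heyting_ids \<union> {
     Zero\<^sup>\<sim> \<approx> One,
     One\<^sup>\<sim> \<approx> Zero,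
     (vx \<curlywedge> vy)\<^sup>\<sim> \<approx> vx\<^sup>\<sim> \<curlyvee> vy\<^sup>\<sim>,
     (vx \<curlyvee> vy)\<^sup>\<sim>\<^sup>\<sim> \<approx> vx\<^sup>\<sim>\<^sup>\<sim> \<curlyvee> vy\<^sup>\<sim>\<^sup>\<sim>,
     vx\<^sup>\<sim>\<^sup>\<sim> \<curlywedge> vx \<approx> vx\<^sup>\<sim>\<^sup>\<sim>}"

definition DQD :: "'a alg set" where
  "DQD = Mod DQD_ids"

definition DSt :: "'a alg set" where
  "DSt = DQD \<inter> Mod {vx\<^sup>\<sim> \<curlywedge> vx\<^sup>\<sim>\<^sup>\<sim> \<approx> Zero}"

definition JID :: "'a alg set" where
  "JID = DQD \<inter> Mod {vx\<^sup>\<sim> \<curlyvee> (vy \<rightharpoonup> vz) \<approx> (vx\<^sup>\<sim> \<curlyvee> vy) \<rightharpoonup> (vx\<^sup>\<sim> \<curlyvee> vz)}"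

definition JID1 :: "'a alg set" where
  "JID1 = JID \<inter> Mod {vx \<curlywedge> vx\<^sup>\<sim>\<^sup>\<star> \<approx> (vx \<curlywedge> vx\<^sup>\<sim>\<^sup>\<star>)\<^sup>\<sim>\<^sup>\<star>}"


section \<open>The algebras \<open>D\<^sub>1\<close>, \<open>D\<^sub>2\<close>, \<open>D\<^sub>3\<close>\<close>

datatype four = E0 | E1 | Ea | Eb

fun four_join :: "four \<Rightarrow> four \<Rightarrow> four" where
  "four_join E0 y = y"
| "four_join x E0 = x"
| "four_join x y = (if x = y then x else E1)"

fun four_meet :: "four \<Rightarrow> four \<Rightarrow> four" where
  "four_meet E1 y = y"
| "four_meet x E1 = x"
| "four_meet x y = (if x = y then x else E0)"

primrec four_neg :: "four \<Rightarrow> four" where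
  "four_neg E0 = E1"
| "four_neg E1 = E0"
| "four_neg Ea = Ea"
| "four_neg Eb = Eb"

text \<open>A row lists \<open>(x \<rightarrow> 0, x \<rightarrow> 1, x \<rightarrow> a, x \<rightarrow> b)\<close>; the rows of a table are ordered
  \<open>x = 0, 1, a, b\<close>.\<close>

fun entry :: "'c \<times> 'c \<times> 'c \<times> 'c \<Rightarrow> four \<Rightarrow> 'c" where
  "entry (c0, c1, ca, cb) y = (case y of E0 \<Rightarrow> c0 | E1 \<Rightarrow> c1 | Ea \<Rightarrow> ca | Eb \<Rightarrow> cb)"

definition imp1 :: "four \<Rightarrow> four \<Rightarrow> four" where
  "imp1 x = entry (entry
     ((E1, E0, Eb, Ea),
      (E0, E1, Ea, Eb),
      (Eb, Ea, E1, E0),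
      (Ea, Eb, E0, E1)) x)"

definition imp2 :: "four \<Rightarrow> four \<Rightarrow> four" where
  "imp2 x = entry (entry
     ((E1, E1, E1, E1),
      (E0, E1, Ea, Eb),
      (Eb, E1, E1, Eb),
      (Ea, E1, Ea, E1)) x)"

definition imp3 :: "four \<Rightarrow> four \<Rightarrow> four" where
  "imp3 x = entry (entry
     ((E1, Ea, E1, Ea),
      (E0, E1, Ea, Eb),
      (Eb, Ea, E1, E0),
      (Ea, E1, Ea, E1)) x)"

definition four_alg :: "(four \<Rightarrow> four \<Rightarrow> four) \<Rightarrow> four alg" where
  "four_alg imp = \<lparr>carr = UNIV, jn = four_join, mt = four_meet, im = imp, ng = four_neg,
     zr = E0, on = E1\<rparr>"

definition D1 :: "four alg" where "D1 = four_alg imp1"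
definition D2 :: "four alg" where "D2 = four_alg imp2"
definition D3 :: "four alg" where "D3 = four_alg imp3"

text \<open>The generators are given up to isomorphism, so as to have them with universe in \<open>'a\<close>.\<close>

definition V_D1_D2_D3 :: "'a alg set" where
  "V_D1_D2_D3 =
     generated_variety {A. isomorphic A D1 \<or> isomorphic A D2 \<or> isomorphic A D3}"

end

theory Submission
  imports Defs
begin

text \<open>
  Write \<open>e(x) = x \<and> x'*\<close>. In \<open>JID\<close> every \<open>x'\<close> is complemented by \<open>x'*\<close>
  (\<open>neg_join_star\<close>); conversely, if \<open>x'\<close> is complemented, then the identity of \<open>JID\<close> holds for
  \<open>x\<close>, \<open>y\<close>, \<open>z\<close> (\<open>join_imp_complemented\<close>). In \<open>DSt\<close> the complement of \<open>x'\<close> is \<open>x''\<close>, whence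
  \<open>DSt \<subseteq> JID1\<close>. That \<open>D1\<close>, \<open>D2\<close>, \<open>D3\<close> lie in \<open>JID1\<close> is a finite check, so the join is
  contained in \<open>JID1\<close>.

  For the converse, call \<open>e\<close> a factor element if \<open>e \<and> e' = 0\<close>. Then \<open>e\<close> and \<open>e'\<close> are complements
  and \<open>e'' = e\<close>, and \<open>x \<and> e = y \<and> e\<close> defines a congruence. In \<open>JID1\<close> every \<open>e(x)\<close> is a factor
  element (\<open>meet_neg_star_factor\<close>). Given \<open>a \<noteq> b\<close>, Zorn's lemma yields a filter base \<open>F\<close> of factor
  elements that does not identify \<open>a\<close> and \<open>b\<close> and contains \<open>e\<close> or \<open>e'\<close> for each factor element
  \<open>e\<close> (\<open>deciding_filter_base\<close>). In the quotient by \<open>F\<close> every \<open>e(x)\<close> is \<open>0\<close> or \<open>1\<close>, which means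
  that each \<open>x\<close> is \<open>1\<close> or below \<open>x'\<close> (\<open>separating_quotient\<close>).

  In such a quotient each \<open>x\<close> satisfies \<open>x = 1\<close>, \<open>x' = 1\<close> or \<open>x' = x\<close>. If \<open>x' = x\<close> occurs only for
  \<open>x = 1\<close>, the quotient is in \<open>DSt\<close>. Otherwise a fixed point \<open>a \<noteq> 1\<close> and its complement are atoms,
  and the quotient has four elements; its implication is determined by \<open>0 \<rightarrow> 1\<close>, the values
  \<open>0\<close>, \<open>1\<close>, \<open>a\<close>, \<open>b\<close> giving \<open>D1\<close>, \<open>D2\<close>, \<open>D3\<close> and again \<open>D3\<close> with the atoms exchanged
  (\<open>DSt_or_four_element\<close>). So the algebras of \<open>JID1\<close> satisfy every identity that is valid in \<open>DSt\<close>
  and in \<open>D1\<close>, \<open>D2\<close>, \<open>D3\<close>.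
\<close>


section \<open>Homomorphisms and quotients\<close>

text \<open>A homomorphism need not map the carrier of \<open>A\<close> into that of \<open>B\<close> by this definition; the
  lemmas that need it assume \<open>h ` carr A = carr B\<close> or a bijection of the carriers.\<close>

definition hom :: "('a \<Rightarrow> 'b) \<Rightarrow> 'a alg \<Rightarrow> 'b alg \<Rightarrow> bool" where
  "hom h A B \<longleftrightarrow>
     h (zr A) = zr B \<and> h (on A) = on B \<and>
     (\<forall>x\<in>carr A. h (ng A x) = ng B (h x)) \<and>
     (\<forall>x\<in>carr A. \<forall>y\<in>carr A.
        h (jn A x y) = jn B (h x) (h y) \<and>
        h (mt A x y) = mt B (h x) (h y) \<and>
        h (im A x y) = im B (h x) (h y))"

lemma eval_closed:
  assumes "is_alg A" "range v \<subseteq> carr A"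
  shows "eval A v t \<in> carr A"
  using assms by (induction t) (auto simp: is_alg_def)

lemma eval_hom:
  assumes "is_alg A" "hom h A B" "range v \<subseteq> carr A"
  shows "h (eval A v t) = eval B (h \<circ> v) t"
  using assms eval_closed[OF assms(1,3)] by (induction t) (auto simp: hom_def)

lemma holds_hom_image:
  assumes "is_alg A" "hom h A B" "h ` carr A = carr B" "holds A e"
  shows "holds B e"
proof (cases e)
  case (Eq s t)
  have "eval B w s = eval B w t" if w: "range w \<subseteq> carr B" for w
  proof -
    define v where "v = inv_into (carr A) h \<circ> w"
    have v: "range v \<subseteq> carr A" and hv: "h \<circ> v = w"
      using w assms(3) by (auto simp: v_def fun_eq_iff f_inv_into_f inv_into_into subset_iff)
    show ?thesis
      using eval_hom[OF assms(1,2) v] assms(4) v by (simp add: Eq hv) metis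
  qed
  then show ?thesis by (simp add: Eq)
qed

lemma Mod_hom_image:
  assumes "hom h A B" "h ` carr A = carr B" "is_alg B" "A \<in> Mod E"
  shows "B \<in> Mod E"
  using assms holds_hom_image[of A h B] by (auto simp: Mod_def)

lemma Mod_isomorphic:
  assumes "isomorphic A B" "B \<in> Mod E"
  shows "A \<in> Mod E"
proof -
  from assms(1) obtain f where A: "is_alg A" and f: "bij_betw f (carr A) (carr B)" "hom f A B"
    unfolding isomorphic_def hom_def by auto
  have "holds A e" if "holds B e" for e
  proof (cases e)
    case (Eq s t)
    have "eval A v s = eval A v t" if v: "range v \<subseteq> carr A" for v
    proof -
      have "range (f \<circ> v) \<subseteq> carr B"
        using v f(1) by (auto simp: bij_betw_def)
      then have "f (eval A v s) = f (eval A v t)"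
        using eval_hom[OF A f(2) v] \<open>holds B e\<close> by (simp add: Eq)
      then show ?thesis
        using f(1) eval_closed[OF A v] by (auto simp: bij_betw_def inj_on_def)
    qed
    then show ?thesis by (simp add: Eq)
  qed
  then show ?thesis
    using A assms(2) by (auto simp: Mod_def)
qed

text \<open>Congruences are relations on the carrier that are equivalences compatible with all
  operations.\<close>

definition congruence :: "'a alg \<Rightarrow> ('a \<times> 'a) set \<Rightarrow> bool" where
  "congruence A R \<longleftrightarrow> equiv (carr A) R \<and>
     (\<forall>(x, y)\<in>R. (ng A x, ng A y) \<in> R) \<and>
     (\<forall>(x, y)\<in>R. \<forall>(u, w)\<in>R.
        (jn A x u, jn A y w) \<in> R \<and> (mt A x u, mt A y w) \<in> R \<and> (im A x u, im A y w) \<in> R)"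

text \<open>The quotient is built on a set of representatives of the classes, so that its universe
  is again a subset of \<open>'a\<close>.\<close>

lemma quotient_exists:
  fixes A :: "'a alg"
  assumes A: "is_alg A" and R: "congruence A R"
  obtains B :: "'a alg" and h where "is_alg B" "hom h A B" "h ` carr A = carr B"
    "\<And>x y. x \<in> carr A \<Longrightarrow> y \<in> carr A \<Longrightarrow> h x = h y \<longleftrightarrow> (x, y) \<in> R"
proof -
  define h where "h x = (SOME y. (x, y) \<in> R)" for x
  define B where "B = \<lparr>carr = h ` carr A, jn = \<lambda>x y. h (jn A x y), mt = \<lambda>x y. h (mt A x y),
    im = \<lambda>x y. h (im A x y), ng = \<lambda>x. h (ng A x), zr = h (zr A), on = h (on A)\<rparr>"
  have eq: "equiv (carr A) R" using R by (simp add: congruence_def)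
  have hR: "(x, h x) \<in> R" if "x \<in> carr A" for x
    unfolding h_def by (rule someI) (use eq that in \<open>auto simp: equiv_def refl_on_def\<close>)
  have h_eq: "h x = h y" if "(x, y) \<in> R" for x y
  proof -
    have "(x, z) \<in> R \<longleftrightarrow> (y, z) \<in> R" for z
      using eq that by (meson equivE symD transD)
    then show ?thesis by (simp add: h_def)
  qed
  have h_carr: "h x \<in> carr A" if "x \<in> carr A" for x
    using hR[OF that] eq by (auto simp: equiv_def)
  show thesis
  proof (rule that[of B h])
    show "is_alg B"
      using A h_carr by (auto simp: is_alg_def B_def)
    have "h (ng A x) = h (ng A (h x))" if "x \<in> carr A" for x
      using R hR[OF that] by (intro h_eq) (auto simp: congruence_def)
    moreover have "h (jn A x y) = h (jn A (h x) (h y))" "h (mt A x y) = h (mt A (h x) (h y))"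
      "h (im A x y) = h (im A (h x) (h y))" if "x \<in> carr A" "y \<in> carr A" for x y
      using R hR[OF that(1)] hR[OF that(2)] by (intro h_eq; fastforce simp: congruence_def)+
    ultimately show "hom h A B"
      by (simp add: hom_def B_def)
    show "h ` carr A = carr B" by (simp add: B_def)
    show "h x = h y \<longleftrightarrow> (x, y) \<in> R" if "x \<in> carr A" "y \<in> carr A" for x y
      using h_eq hR[OF that(1)] hR[OF that(2)] eq by (metis equivE symD transD)
  qed
qed


section \<open>Arithmetic of dually quasi-De Morgan semi-Heyting algebras\<close>

lemma holds_elements:
  assumes "holds A (s \<approx> t)" "x \<in> carr A" "y \<in> carr A" "z \<in> carr A"
  shows "eval A (\<lambda>n. if n = 0 then x else if n = 1 then y else z) s =
         eval A (\<lambda>n. if n = 0 then x else if n = 1 then y else z) t"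
proof -
  let ?v = "\<lambda>n::nat. if n = 0 then x else if n = 1 then y else z"
  have "range ?v \<subseteq> carr A" using assms(2-4) by (simp add: image_subset_iff)
  then show ?thesis using assms(1) unfolding holds.simps by blast
qed

text \<open>The arguments of the operations range over the carrier only, so each law below carries
  membership assumptions. The order \<open>\<sqsubseteq>\<close> abbreviates an equation between meets.\<close>

locale DQD_algebra =
  fixes A :: "'a alg"
  assumes in_DQD: "A \<in> DQD"
begin

abbreviation join (infixl "\<squnion>" 65) where "x \<squnion> y \<equiv> jn A x y"
abbreviation meet (infixl "\<sqinter>" 70) where "x \<sqinter> y \<equiv> mt A x y"
abbreviation imp (infixr "\<leadsto>" 60) where "x \<leadsto> y \<equiv> im A x y"
abbreviation neg ("\<sim> _" [80] 80) where "\<sim> x \<equiv> ng A x"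
abbreviation bot ("\<zero>") where "\<zero> \<equiv> zr A"
abbreviation top ("\<one>") where "\<one> \<equiv> on A"
abbreviation le (infix "\<sqsubseteq>" 50) where "x \<sqsubseteq> y \<equiv> x \<sqinter> y = x"

lemma alg: "is_alg A"
  using in_DQD by (simp add: DQD_def Mod_def)

lemma closed [simp]:
  "\<zero> \<in> carr A" "\<one> \<in> carr A"
  "x \<in> carr A \<Longrightarrow> \<sim> x \<in> carr A"
  "x \<in> carr A \<Longrightarrow> y \<in> carr A \<Longrightarrow> x \<squnion> y \<in> carr A"
  "x \<in> carr A \<Longrightarrow> y \<in> carr A \<Longrightarrow> x \<sqinter> y \<in> carr A"
  "x \<in> carr A \<Longrightarrow> y \<in> carr A \<Longrightarrow> x \<leadsto> y \<in> carr A"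
  using alg by (auto simp: is_alg_def)

lemma DQD_holds: "e \<in> DQD_ids \<Longrightarrow> holds A e"
  using in_DQD by (simp add: DQD_def Mod_def)

lemma ternary_identities:
  assumes "x \<in> carr A" "y \<in> carr A" "z \<in> carr A"
  shows join_assoc: "(x \<squnion> y) \<squnion> z = x \<squnion> (y \<squnion> z)"
    and meet_assoc: "(x \<sqinter> y) \<sqinter> z = x \<sqinter> (y \<sqinter> z)"
    and meet_imp_meet: "x \<sqinter> (y \<leadsto> z) = x \<sqinter> ((x \<sqinter> y) \<leadsto> (x \<sqinter> z))"
proof -
  have ids: "holds A (vx \<curlyvee> (vy \<curlyvee> vz) \<approx> (vx \<curlyvee> vy) \<curlyvee> vz)"
    "holds A (vx \<curlywedge> (vy \<curlywedge> vz) \<approx> (vx \<curlywedge> vy) \<curlywedge> vz)"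
    "holds A (vx \<curlywedge> (vy \<rightharpoonup> vz) \<approx> vx \<curlywedge> ((vx \<curlywedge> vy) \<rightharpoonup> (vx \<curlywedge> vz)))"
    by (rule DQD_holds, simp add: DQD_ids_def semi_Heyting_ids_def bounded_lattice_ids_def)+
  show "(x \<squnion> y) \<squnion> z = x \<squnion> (y \<squnion> z)"
    "(x \<sqinter> y) \<sqinter> z = x \<sqinter> (y \<sqinter> z)" "x \<sqinter> (y \<leadsto> z) = x \<sqinter> ((x \<sqinter> y) \<leadsto> (x \<sqinter> z))"
    using ids[THEN holds_elements, OF assms] by simp_all
qed

lemma binary_identities:
  assumes "x \<in> carr A" "y \<in> carr A"
  shows join_comm: "x \<squnion> y = y \<squnion> x"
    and meet_comm: "x \<sqinter> y = y \<sqinter> x"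
    and join_meet_absorb: "x \<squnion> (x \<sqinter> y) = x"
    and meet_join_absorb: "x \<sqinter> (x \<squnion> y) = x"
    and meet_imp: "x \<sqinter> (x \<leadsto> y) = x \<sqinter> y"
    and neg_meet: "\<sim> (x \<sqinter> y) = \<sim> x \<squnion> \<sim> y"
    and neg_neg_join: "\<sim> \<sim> (x \<squnion> y) = \<sim> \<sim> x \<squnion> \<sim> \<sim> y"
proof -
  have ids: "holds A (vx \<curlyvee> vy \<approx> vy \<curlyvee> vx)" "holds A (vx \<curlywedge> vy \<approx> vy \<curlywedge> vx)"
    "holds A (vx \<approx> vx \<curlyvee> (vx \<curlywedge> vy))" "holds A (vx \<approx> vx \<curlywedge> (vx \<curlyvee> vy))"
    "holds A (vx \<curlywedge> (vx \<rightharpoonup> vy) \<approx> vx \<curlywedge> vy)"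
    "holds A ((vx \<curlywedge> vy)\<^sup>\<sim> \<approx> vx\<^sup>\<sim> \<curlyvee> vy\<^sup>\<sim>)"
    "holds A ((vx \<curlyvee> vy)\<^sup>\<sim>\<^sup>\<sim> \<approx> vx\<^sup>\<sim>\<^sup>\<sim> \<curlyvee> vy\<^sup>\<sim>\<^sup>\<sim>)"
    by (rule DQD_holds, simp add: DQD_ids_def semi_Heyting_ids_def bounded_lattice_ids_def)+
  show "x \<squnion> y = y \<squnion> x" "x \<sqinter> y = y \<sqinter> x" "x \<squnion> (x \<sqinter> y) = x" "x \<sqinter> (x \<squnion> y) = x" "x \<sqinter> (x \<leadsto> y) = x \<sqinter> y"
    "\<sim> (x \<sqinter> y) = \<sim> x \<squnion> \<sim> y" "\<sim> \<sim> (x \<squnion> y) = \<sim> \<sim> x \<squnion> \<sim> \<sim> y"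
    using ids[THEN holds_elements, OF assms assms(1)] by simp_all
qed

lemma unary_identities:
  assumes "x \<in> carr A"
  shows join_idem [simp]: "x \<squnion> x = x"
    and meet_idem [simp]: "x \<sqinter> x = x"
    and meet_bot_right [simp]: "x \<sqinter> \<zero> = \<zero>"
    and join_top_right [simp]: "x \<squnion> \<one> = \<one>"
    and imp_self [simp]: "x \<leadsto> x = \<one>"
    and neg_neg_meet: "\<sim> \<sim> x \<sqinter> x = \<sim> \<sim> x"
proof -
  have ids: "holds A (vx \<curlyvee> vx \<approx> vx)" "holds A (vx \<curlywedge> vx \<approx> vx)" "holds A (vx \<curlywedge> Zero \<approx> Zero)"
    "holds A (vx \<curlyvee> One \<approx> One)" "holds A (vx \<rightharpoonup> vx \<approx> One)"
    "holds A (vx\<^sup>\<sim>\<^sup>\<sim> \<curlywedge> vx \<approx> vx\<^sup>\<sim>\<^sup>\<sim>)"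
    by (rule DQD_holds, simp add: DQD_ids_def semi_Heyting_ids_def bounded_lattice_ids_def)+
  show "x \<squnion> x = x" "x \<sqinter> x = x" "x \<sqinter> \<zero> = \<zero>" "x \<squnion> \<one> = \<one>" "x \<leadsto> x = \<one>"
    "\<sim> \<sim> x \<sqinter> x = \<sim> \<sim> x"
    using ids[THEN holds_elements, OF assms assms assms] by simp_all
qed

lemma neg_bot [simp]: "\<sim> \<zero> = \<one>" and neg_top [simp]: "\<sim> \<one> = \<zero>"
proof -
  have ids: "holds A (Zero\<^sup>\<sim> \<approx> One)" "holds A (One\<^sup>\<sim> \<approx> Zero)"
    by (rule DQD_holds, simp add: DQD_ids_def)+
  show "\<sim> \<zero> = \<one>" "\<sim> \<one> = \<zero>"
    using ids[THEN holds_elements, OF closed(1) closed(1) closed(1)] by simp_all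
qed

lemma bounds [simp]:
  assumes "x \<in> carr A"
  shows "\<zero> \<sqinter> x = \<zero>" "\<one> \<squnion> x = \<one>" "x \<sqinter> \<one> = x" "\<one> \<sqinter> x = x" "x \<squnion> \<zero> = x" "\<zero> \<squnion> x = x"
  using assms unary_identities[OF assms] binary_identities[of x \<one>] binary_identities[of x \<zero>] by simp_all

lemma meet_left_comm:
  "x \<in> carr A \<Longrightarrow> y \<in> carr A \<Longrightarrow> z \<in> carr A \<Longrightarrow> x \<sqinter> (y \<sqinter> z) = y \<sqinter> (x \<sqinter> z)"
  by (metis meet_assoc meet_comm)

lemma meet_left_idem: "x \<in> carr A \<Longrightarrow> y \<in> carr A \<Longrightarrow> x \<sqinter> (x \<sqinter> y) = x \<sqinter> y"
  by (metis meet_assoc meet_idem)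

lemmas meet_ac = meet_assoc meet_comm meet_left_comm meet_left_idem

lemma le_join_iff: "x \<in> carr A \<Longrightarrow> y \<in> carr A \<Longrightarrow> x \<sqsubseteq> y \<longleftrightarrow> x \<squnion> y = y"
  by (metis join_comm join_meet_absorb meet_comm meet_join_absorb)

lemma le_antisym: "x \<in> carr A \<Longrightarrow> y \<in> carr A \<Longrightarrow> x \<sqsubseteq> y \<Longrightarrow> y \<sqsubseteq> x \<Longrightarrow> x = y"
  by (metis meet_comm)

lemma join_least:
  "x \<in> carr A \<Longrightarrow> y \<in> carr A \<Longrightarrow> z \<in> carr A \<Longrightarrow> x \<sqsubseteq> z \<Longrightarrow> y \<sqsubseteq> z \<Longrightarrow> x \<squnion> y \<sqsubseteq> z"
  by (simp add: le_join_iff join_assoc)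

text \<open>The element \<open>x \<leadsto> (x \<sqinter> y)\<close> is the pseudocomplement of \<open>x\<close> relative to \<open>y\<close>, so the
  lattice is distributive.\<close>

lemma residuation:
  assumes "x \<in> carr A" "y \<in> carr A" "z \<in> carr A"
  shows "z \<sqinter> x \<sqsubseteq> y \<longleftrightarrow> z \<sqsubseteq> (x \<leadsto> (x \<sqinter> y))"
proof
  assume *: "z \<sqinter> x \<sqsubseteq> y"
  have "z \<sqinter> (x \<leadsto> (x \<sqinter> y)) = z \<sqinter> ((z \<sqinter> x) \<leadsto> (z \<sqinter> x \<sqinter> y))"
    using assms meet_imp_meet[of z x "x \<sqinter> y"] by (simp add: meet_assoc)
  then show "z \<sqsubseteq> (x \<leadsto> (x \<sqinter> y))"
    using assms by (simp add: *)
next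
  assume *: "z \<sqsubseteq> (x \<leadsto> (x \<sqinter> y))"
  have "z \<sqinter> x = z \<sqinter> (x \<sqinter> (x \<leadsto> (x \<sqinter> y)))"
    using assms * by (metis closed(5,6) meet_assoc meet_comm)
  also have "\<dots> = z \<sqinter> (x \<sqinter> y)"
    using assms by (simp add: meet_imp meet_left_idem)
  finally show "z \<sqinter> x \<sqsubseteq> y"
    using assms by (simp add: meet_assoc)
qed

lemma meet_join_distrib:
  assumes "x \<in> carr A" "y \<in> carr A" "z \<in> carr A"
  shows "x \<sqinter> (y \<squnion> z) = (x \<sqinter> y) \<squnion> (x \<sqinter> z)"
proof (rule le_antisym)
  let ?u = "(x \<sqinter> y) \<squnion> (x \<sqinter> z)"
  have "y \<sqinter> x \<sqsubseteq> ?u" "z \<sqinter> x \<sqsubseteq> ?u"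
    using assms by (metis closed(4,5) join_comm meet_comm meet_join_absorb)+
  then have "y \<squnion> z \<sqsubseteq> (x \<leadsto> (x \<sqinter> ?u))"
    using assms by (intro join_least) (simp_all add: residuation[symmetric])
  then show "x \<sqinter> (y \<squnion> z) \<sqsubseteq> ?u"
    using assms residuation[of x ?u "y \<squnion> z"] by (metis closed(4,5) meet_comm)
  have "x \<sqinter> y \<sqsubseteq> x \<sqinter> (y \<squnion> z)" "x \<sqinter> z \<sqsubseteq> x \<sqinter> (y \<squnion> z)"
    using assms by (metis closed(4,5) join_comm meet_assoc meet_comm meet_idem meet_join_absorb)+
  then show "?u \<sqsubseteq> x \<sqinter> (y \<squnion> z)"
    using assms by (intro join_least) simp_all
qed (use assms in simp_all)

lemma meet_join_distrib2:
  "x \<in> carr A \<Longrightarrow> y \<in> carr A \<Longrightarrow> z \<in> carr A \<Longrightarrow> (y \<squnion> z) \<sqinter> x = (y \<sqinter> x) \<squnion> (z \<sqinter> x)"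
  by (metis closed(4) meet_comm meet_join_distrib)

lemma neg_neg_neg:
  assumes "x \<in> carr A"
  shows "\<sim> \<sim> \<sim> x = \<sim> x"
proof (rule le_antisym)
  show "\<sim> \<sim> \<sim> x \<sqsubseteq> \<sim> x"
    using assms by (simp add: neg_neg_meet)
  have "\<sim> \<sim> \<sim> x = \<sim> (\<sim> \<sim> x \<sqinter> x)"
    using assms by (simp only: neg_neg_meet)
  also have "\<dots> = \<sim> x \<squnion> \<sim> \<sim> \<sim> x"
    using assms by (simp add: neg_meet join_comm)
  finally show "\<sim> x \<sqsubseteq> \<sim> \<sim> \<sim> x"
    using assms by (simp add: le_join_iff)
qed (use assms in simp_all)

text \<open>Elements with equal meets with each of two elements whose join is the top are equal.\<close>

lemma eq_by_cover:
  assumes "c \<in> carr A" "d \<in> carr A" "c \<squnion> d = \<one>" "x \<in> carr A" "y \<in> carr A"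
    and "c \<sqinter> x = c \<sqinter> y" "d \<sqinter> x = d \<sqinter> y"
  shows "x = y"
  using assms by (metis bounds(4) meet_join_distrib2)

lemma meet_star [simp]: "x \<in> carr A \<Longrightarrow> x \<sqinter> (x \<leadsto> \<zero>) = \<zero>"
  by (simp add: meet_imp)

lemma star_eqI:
  assumes "c \<in> carr A" "d \<in> carr A" "c \<squnion> d = \<one>" "c \<sqinter> d = \<zero>"
  shows "c \<leadsto> \<zero> = d"
proof (rule eq_by_cover[OF assms(1-3)])
  have "d \<sqinter> (c \<leadsto> \<zero>) = d \<sqinter> ((d \<sqinter> c) \<leadsto> (d \<sqinter> \<zero>))"
    using assms by (intro meet_imp_meet) simp_all
  then show "d \<sqinter> (c \<leadsto> \<zero>) = d \<sqinter> d"
    using assms by (simp add: meet_comm[of d c])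
qed (use assms in simp_all)

text \<open>For complemented \<open>c\<close> the defining identity of \<open>JID\<close> holds with \<open>c\<close> in place of \<open>x'\<close>.\<close>

lemma join_imp_complemented:
  assumes cd: "c \<in> carr A" "d \<in> carr A" "c \<squnion> d = \<one>" "c \<sqinter> d = \<zero>"
    and yz: "y \<in> carr A" "z \<in> carr A"
  shows "c \<squnion> (y \<leadsto> z) = (c \<squnion> y) \<leadsto> (c \<squnion> z)"
proof (rule eq_by_cover[OF cd(1-3)])
  show "c \<sqinter> (c \<squnion> (y \<leadsto> z)) = c \<sqinter> ((c \<squnion> y) \<leadsto> (c \<squnion> z))"
    using cd yz meet_imp_meet[of c "c \<squnion> y" "c \<squnion> z"] by (simp add: meet_join_absorb)
  have d: "d \<sqinter> (c \<squnion> x) = d \<sqinter> x" if "x \<in> carr A" for x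
    using cd that by (simp add: meet_join_distrib meet_comm[of d c])
  show "d \<sqinter> (c \<squnion> (y \<leadsto> z)) = d \<sqinter> ((c \<squnion> y) \<leadsto> (c \<squnion> z))"
    using cd yz meet_imp_meet[of d y z] meet_imp_meet[of d "c \<squnion> y" "c \<squnion> z"] by (simp add: d)
qed (use cd yz in simp_all)


section \<open>Factor elements and the congruences they induce\<close>

text \<open>The single equation \<open>e \<sqinter> \<sim> e = \<zero>\<close> already makes \<open>\<sim> e\<close> a complement of \<open>e\<close> and \<open>e\<close> a fixed point
  of double negation, so that \<open>e\<close> and \<open>\<sim> e\<close> split the algebra into a direct product.\<close>

definition factors :: "'a set" where
  "factors = {e \<in> carr A. e \<sqinter> \<sim> e = \<zero>}"

lemma factors_carr: "e \<in> factors \<Longrightarrow> e \<in> carr A"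
  by (simp add: factors_def)

lemma factors_meet_neg: "e \<in> factors \<Longrightarrow> e \<sqinter> \<sim> e = \<zero>"
  by (simp add: factors_def)

lemma factors_neg_neg_join:
  assumes "e \<in> factors"
  shows "\<sim> \<sim> e \<squnion> \<sim> e = \<one>"
  using assms neg_meet[of e "\<sim> e"] by (simp add: factors_def join_comm)

lemma factors_neg_neg:
  assumes "e \<in> factors"
  shows "\<sim> \<sim> e = e"
proof -
  have e: "e \<in> carr A" by (rule factors_carr[OF assms])
  have "e = e \<sqinter> (\<sim> \<sim> e \<squnion> \<sim> e)"
    using e by (simp add: factors_neg_neg_join assms)
  also have "\<dots> = \<sim> \<sim> e"
    using e by (simp add: meet_join_distrib factors_meet_neg assms meet_comm[of e "\<sim> \<sim> e"]
        neg_neg_meet)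
  finally show ?thesis by simp
qed

lemma factors_join_neg: "e \<in> factors \<Longrightarrow> e \<squnion> \<sim> e = \<one>"
  using factors_neg_neg_join factors_neg_neg by simp

lemma factors_top: "\<one> \<in> factors"
  by (simp add: factors_def)

lemma factors_neg: "e \<in> factors \<Longrightarrow> \<sim> e \<in> factors"
  using factors_neg_neg[of e] by (simp add: factors_def meet_comm)

lemma factors_meet:
  assumes "e \<in> factors" "f \<in> factors"
  shows "e \<sqinter> f \<in> factors"
proof -
  have c: "e \<in> carr A" "f \<in> carr A" using assms factors_carr by auto
  have "(e \<sqinter> f) \<sqinter> \<sim> e = (e \<sqinter> \<sim> e) \<sqinter> f" "(e \<sqinter> f) \<sqinter> \<sim> f = e \<sqinter> (f \<sqinter> \<sim> f)"
    using c by (simp_all add: meet_ac)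
  then have "(e \<sqinter> f) \<sqinter> \<sim> e = \<zero>" "(e \<sqinter> f) \<sqinter> \<sim> f = \<zero>"
    using c assms by (simp_all add: factors_meet_neg)
  then show ?thesis
    using c by (simp add: factors_def neg_meet meet_join_distrib)
qed

text \<open>Below a factor element \<open>e\<close> the value of \<open>\<sim> x\<close> depends only on \<open>e \<sqinter> x\<close>.\<close>

lemma factors_meet_neg_meet:
  assumes "e \<in> factors" "x \<in> carr A"
  shows "e \<sqinter> \<sim> (e \<sqinter> x) = e \<sqinter> \<sim> x"
  using assms factors_carr[OF assms(1)] by (simp add: neg_meet meet_join_distrib factors_meet_neg)

text \<open>Two elements agree modulo \<open>F\<close> if their meets with some member of \<open>F\<close> coincide. For a
  set \<open>F\<close> of factor elements that contains \<open>\<one>\<close> and is closed under meets, this is the congruence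
  of the filter that \<open>F\<close> generates; closure upwards is not needed.\<close>

definition agreement :: "'a set \<Rightarrow> ('a \<times> 'a) set" where
  "agreement F = {(x, y). x \<in> carr A \<and> y \<in> carr A \<and> (\<exists>e\<in>F. e \<sqinter> x = e \<sqinter> y)}"

lemma congruence_agreement:
  assumes F: "F \<subseteq> factors" "\<one> \<in> F" "\<And>e f. e \<in> F \<Longrightarrow> f \<in> F \<Longrightarrow> e \<sqinter> f \<in> F"
  shows "congruence A (agreement F)"
proof -
  have Fc: "e \<in> carr A" if "e \<in> F" for e
    using that F(1) factors_carr by auto
  have common: "\<exists>g\<in>F. g \<sqinter> x = g \<sqinter> y \<and> g \<sqinter> u = g \<sqinter> w"
    if R: "(x, y) \<in> agreement F" "(u, w) \<in> agreement F" for x y u w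
  proof -
    from R obtain e f where ef: "e \<in> F" "f \<in> F" "e \<sqinter> x = e \<sqinter> y" "f \<sqinter> u = f \<sqinter> w"
      and c: "x \<in> carr A" "y \<in> carr A" "u \<in> carr A" "w \<in> carr A"
      by (auto simp: agreement_def)
    have "(e \<sqinter> f) \<sqinter> x = f \<sqinter> (e \<sqinter> x)" "(e \<sqinter> f) \<sqinter> y = f \<sqinter> (e \<sqinter> y)"
      "(e \<sqinter> f) \<sqinter> u = e \<sqinter> (f \<sqinter> u)" "(e \<sqinter> f) \<sqinter> w = e \<sqinter> (f \<sqinter> w)"
      using c Fc[OF ef(1)] Fc[OF ef(2)] by (simp_all add: meet_ac)
    then show ?thesis using ef F(3) by metis
  qed
  have "trans (agreement F)"
  proof (rule transI)
    fix x y z assume R: "(x, y) \<in> agreement F" "(y, z) \<in> agreement F"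
    from common[OF R] R show "(x, z) \<in> agreement F"
      by (auto simp: agreement_def)
  qed
  moreover have "sym (agreement F)"
    by (rule symI) (auto simp: agreement_def intro: sym)
  moreover have "refl_on (carr A) (agreement F)" "agreement F \<subseteq> carr A \<times> carr A"
    using F(2) by (auto simp: refl_on_def agreement_def)
  ultimately have "equiv (carr A) (agreement F)"
    by (simp add: equiv_def)
  moreover have "(\<sim> x, \<sim> y) \<in> agreement F" if R: "(x, y) \<in> agreement F" for x y
  proof -
    from R obtain e where e: "e \<in> F" "e \<sqinter> x = e \<sqinter> y" and c: "x \<in> carr A" "y \<in> carr A"
      by (auto simp: agreement_def)
    have "e \<sqinter> \<sim> x = e \<sqinter> \<sim> y"
      using e c F(1) factors_meet_neg_meet[of e x] factors_meet_neg_meet[of e y] by auto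
    then show ?thesis using e c by (auto simp: agreement_def)
  qed
  moreover have "(x \<squnion> u, y \<squnion> w) \<in> agreement F \<and> (x \<sqinter> u, y \<sqinter> w) \<in> agreement F \<and>
      (x \<leadsto> u, y \<leadsto> w) \<in> agreement F"
    if R: "(x, y) \<in> agreement F" "(u, w) \<in> agreement F" for x y u w
  proof -
    from common[OF R] obtain e where e: "e \<in> F" "e \<sqinter> x = e \<sqinter> y" "e \<sqinter> u = e \<sqinter> w" by blast
    have c: "x \<in> carr A" "y \<in> carr A" "u \<in> carr A" "w \<in> carr A" "e \<in> carr A"
      using R Fc[OF e(1)] by (auto simp: agreement_def)
    have "e \<sqinter> (x \<squnion> u) = e \<sqinter> (y \<squnion> w)"
      using c e by (simp add: meet_join_distrib)
    moreover have "e \<sqinter> (x \<leadsto> u) = e \<sqinter> (y \<leadsto> w)"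
      using c e meet_imp_meet[of e x u] meet_imp_meet[of e y w] by simp
    moreover have "e \<sqinter> (p \<sqinter> q) = (e \<sqinter> p) \<sqinter> (e \<sqinter> q)" if "p \<in> carr A" "q \<in> carr A" for p q
      using c that by (simp add: meet_ac)
    then have "e \<sqinter> (x \<sqinter> u) = e \<sqinter> (y \<sqinter> w)"
      using c e by simp
    ultimately show ?thesis
      using c e(1) by (auto simp: agreement_def)
  qed
  ultimately show ?thesis
    by (auto simp: congruence_def)
qed

text \<open>The set \<open>F\<close> is chosen maximal among those that do not identify \<open>a\<close> and \<open>b\<close>. If it contained
  neither \<open>e\<close> nor \<open>\<sim> e\<close>, then adjoining either would identify \<open>a\<close> and \<open>b\<close>, hence \<open>F\<close> itself would,
  as \<open>e \<squnion> \<sim> e = \<one>\<close>.\<close>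

lemma deciding_filter_base:
  assumes ab: "a \<in> carr A" "b \<in> carr A" "a \<noteq> b"
  obtains F where "F \<subseteq> factors" "\<one> \<in> F" "\<And>e f. e \<in> F \<Longrightarrow> f \<in> F \<Longrightarrow> e \<sqinter> f \<in> F"
    "(a, b) \<notin> agreement F" "\<And>e. e \<in> factors \<Longrightarrow> e \<in> F \<or> \<sim> e \<in> F"
proof -
  define base where "base F \<longleftrightarrow> F \<subseteq> factors \<and> \<one> \<in> F \<and> (\<forall>e\<in>F. \<forall>f\<in>F. e \<sqinter> f \<in> F) \<and>
    (\<forall>e\<in>F. e \<sqinter> a \<noteq> e \<sqinter> b)" for F
  have "base {\<one>}"
    using ab factors_top by (simp add: base_def)
  moreover have "base (\<Union>C)" if C: "C \<noteq> {}" "subset.chain {F. base F} C" for C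
  proof -
    have "base F" if "F \<in> C" for F
      using C(2) that by (auto simp: subset.chain_def)
    moreover have "e \<sqinter> f \<in> \<Union>C" if ef: "e \<in> \<Union>C" "f \<in> \<Union>C" for e f
    proof -
      from ef obtain F1 F2 where "e \<in> F1" "f \<in> F2" "F1 \<in> C" "F2 \<in> C" by blast
      then have "\<exists>F\<in>C. e \<in> F \<and> f \<in> F"
        using C(2) unfolding subset_chain_def by blast
      then show ?thesis using calculation by (auto simp: base_def)
    qed
    ultimately show ?thesis
      using C(1) unfolding base_def by blast
  qed
  ultimately obtain F where F: "base F" and max: "\<And>F'. base F' \<Longrightarrow> F \<subseteq> F' \<Longrightarrow> F' = F"
    using subset_Zorn_nonempty[of "{F. base F}"] by auto
  have Fc: "e \<in> carr A" if "e \<in> F" for e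
    using that F factors_carr by (auto simp: base_def)
  \<comment> \<open>Adjoining a missing factor element violates maximality, so it must identify \<open>a\<close> and \<open>b\<close>.\<close>
  have extend: "\<exists>f\<in>F. (f \<sqinter> e) \<sqinter> a = (f \<sqinter> e) \<sqinter> b" if e: "e \<in> factors" "e \<notin> F" for e
  proof (rule ccontr)
    assume no: "\<not> ?thesis"
    note ec = factors_carr[OF e(1)]
    let ?F = "F \<union> (\<lambda>f. f \<sqinter> e) ` F"
    have closed': "x \<sqinter> y \<in> ?F" if "x \<in> ?F" "y \<in> ?F" for x y
    proof -
      have "f \<sqinter> g \<in> F \<and> f \<sqinter> (g \<sqinter> e) = (f \<sqinter> g) \<sqinter> e \<and> (f \<sqinter> e) \<sqinter> g = (f \<sqinter> g) \<sqinter> e \<and>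
          (f \<sqinter> e) \<sqinter> (g \<sqinter> e) = (f \<sqinter> g) \<sqinter> e" if "f \<in> F" "g \<in> F" for f g
        using that F Fc[OF that(1)] Fc[OF that(2)] ec by (simp add: base_def meet_ac)
      then show ?thesis using that by auto
    qed
    moreover have "?F \<subseteq> factors"
      using F e(1) factors_meet by (auto simp: base_def)
    ultimately have "base ?F"
      using F no by (auto simp: base_def)
    then have "?F = F" using max by blast
    moreover have "\<one> \<sqinter> e \<in> ?F" using F by (auto simp: base_def)
    ultimately show False using e ec by simp
  qed
  have decide: "e \<in> F \<or> \<sim> e \<in> F" if e: "e \<in> factors" for e
  proof (rule ccontr)
    assume "\<not> ?thesis"
    then obtain f g where fg: "f \<in> F" "g \<in> F" "(f \<sqinter> e) \<sqinter> a = (f \<sqinter> e) \<sqinter> b"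
      "(g \<sqinter> \<sim> e) \<sqinter> a = (g \<sqinter> \<sim> e) \<sqinter> b"
      using extend[OF e] extend[OF factors_neg[OF e]] by auto
    note c = ab(1,2) factors_carr[OF e] Fc[OF fg(1)] Fc[OF fg(2)]
    have "e \<sqinter> ((f \<sqinter> g) \<sqinter> x) = g \<sqinter> ((f \<sqinter> e) \<sqinter> x)"
      "\<sim> e \<sqinter> ((f \<sqinter> g) \<sqinter> x) = f \<sqinter> ((g \<sqinter> \<sim> e) \<sqinter> x)" if "x \<in> carr A" for x
      using c that by (simp_all add: meet_ac)
    then have "(f \<sqinter> g) \<sqinter> a = (f \<sqinter> g) \<sqinter> b"
      using c fg by (simp add: eq_by_cover[of e "\<sim> e"] factors_join_neg e)
    then show False using F fg by (auto simp: base_def)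
  qed
  show thesis
    by (rule that[of F]) (use F decide in \<open>auto simp: base_def agreement_def\<close>)
qed

end


section \<open>Reduction to algebras without proper factor elements\<close>

locale JID1_algebra = DQD_algebra +
  assumes in_JID1: "A \<in> JID1"
begin

text \<open>This is the defining identity of \<open>JID\<close> at \<open>y = x'\<close>, \<open>z = 0\<close>.\<close>

lemma neg_join_star:
  assumes "x \<in> carr A"
  shows "\<sim> x \<squnion> (\<sim> x \<leadsto> \<zero>) = \<one>"
proof -
  have "holds A (vx\<^sup>\<sim> \<curlyvee> (vy \<rightharpoonup> vz) \<approx> (vx\<^sup>\<sim> \<curlyvee> vy) \<rightharpoonup> (vx\<^sup>\<sim> \<curlyvee> vz))"
    using in_JID1 by (auto simp: JID1_def JID_def Mod_def simp del: holds.simps)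
  from holds_elements[OF this assms closed(3)[OF assms] closed(1)]
  show ?thesis using assms by simp
qed

text \<open>The level-1 identity says that \<open>e = x \<sqinter> (\<sim> x \<leadsto> \<zero>)\<close> is the pseudocomplement of \<open>\<sim> e\<close>, hence
  disjoint from it.\<close>

lemma meet_neg_star_factor:
  assumes "x \<in> carr A"
  shows "x \<sqinter> (\<sim> x \<leadsto> \<zero>) \<in> factors"
proof -
  let ?e = "x \<sqinter> (\<sim> x \<leadsto> \<zero>)"
  have "holds A (vx \<curlywedge> vx\<^sup>\<sim>\<^sup>\<star> \<approx> (vx \<curlywedge> vx\<^sup>\<sim>\<^sup>\<star>)\<^sup>\<sim>\<^sup>\<star>)"
    using in_JID1 by (auto simp: JID1_def Mod_def simp del: holds.simps)
  from holds_elements[OF this assms assms assms]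
  have e: "?e = \<sim> ?e \<leadsto> \<zero>" by simp
  have "\<sim> ?e \<sqinter> (\<sim> ?e \<leadsto> \<zero>) = \<zero>" using assms by simp
  then have "\<sim> ?e \<sqinter> ?e = \<zero>" by (simp only: e[symmetric])
  then show ?thesis using assms by (simp add: factors_def meet_comm)
qed

lemma separating_quotient:
  assumes ab: "a \<in> carr A" "b \<in> carr A" "a \<noteq> b"
  obtains B :: "'a alg" and h where "is_alg B" "hom h A B" "h ` carr A = carr B" "h a \<noteq> h b"
    "\<And>x. x \<in> carr B \<Longrightarrow> x = on B \<or> mt B x (ng B x) = x"
proof -
  from deciding_filter_base[OF ab] obtain F where
    F: "F \<subseteq> factors" "\<one> \<in> F" "\<And>e f. e \<in> F \<Longrightarrow> f \<in> F \<Longrightarrow> e \<sqinter> f \<in> F"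
    and nab: "(a, b) \<notin> agreement F"
    and decide: "\<And>e. e \<in> factors \<Longrightarrow> e \<in> F \<or> \<sim> e \<in> F"
    by metis
  from quotient_exists[OF alg congruence_agreement[OF F]]
  obtain B :: "'a alg" and h where B: "is_alg B" "hom h A B" "h ` carr A = carr B"
    and h: "\<And>x y. x \<in> carr A \<Longrightarrow> y \<in> carr A \<Longrightarrow> h x = h y \<longleftrightarrow> (x, y) \<in> agreement F"
    by blast
  have top_or_le: "h x = on B \<or> mt B (h x) (ng B (h x)) = h x" if x: "x \<in> carr A" for x
  proof -
    let ?e = "x \<sqinter> (\<sim> x \<leadsto> \<zero>)"
    have e: "?e \<in> factors" "?e \<in> carr A"
      using x by (simp_all add: meet_neg_star_factor)
    have x_eq: "(x \<sqinter> \<sim> x) \<squnion> ?e = x"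
      using x meet_join_distrib[of x "\<sim> x" "\<sim> x \<leadsto> \<zero>"] by (simp add: neg_join_star)
    \<comment> \<open>If \<open>?e\<close> is in \<open>F\<close>, then \<open>x\<close> becomes \<open>\<one>\<close> since \<open>?e \<sqsubseteq> x\<close>; otherwise \<open>?e\<close> becomes \<open>\<zero>\<close>, and \<open>x\<close>
      becomes \<open>x \<sqinter> \<sim> x\<close>.\<close>
    from decide[OF e(1)] show ?thesis
    proof
      assume "?e \<in> F"
      moreover have "?e \<sqinter> x = ?e \<sqinter> \<one>"
        using x by (simp add: meet_ac)
      ultimately have "h x = h \<one>"
        using x h[of x \<one>] closed(2) unfolding agreement_def by blast
      then show ?thesis using B(2) by (simp add: hom_def)
    next
      assume "\<sim> ?e \<in> F"
      moreover have "\<sim> ?e \<sqinter> x = \<sim> ?e \<sqinter> ((x \<sqinter> \<sim> x) \<squnion> ?e)"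
        by (simp only: x_eq)
      then have "\<sim> ?e \<sqinter> x = (\<sim> ?e \<sqinter> (x \<sqinter> \<sim> x)) \<squnion> (\<sim> ?e \<sqinter> ?e)"
        using x by (simp only: meet_join_distrib closed)
      then have "\<sim> ?e \<sqinter> x = \<sim> ?e \<sqinter> (x \<sqinter> \<sim> x)"
        using x e factors_meet_neg[OF e(1)] meet_comm[of "\<sim> ?e" ?e] by simp
      ultimately have "h (x \<sqinter> \<sim> x) = h x"
        using x h[of x "x \<sqinter> \<sim> x"] closed(3,5) unfolding agreement_def by fastforce
      then show ?thesis using B(2) x by (simp add: hom_def)
    qed
  qed
  show thesis
  proof (rule that[OF B])
    show "h a \<noteq> h b" using ab nab by (simp add: h)
    show "x = on B \<or> mt B x (ng B x) = x" if "x \<in> carr B" for x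
      using top_or_le that unfolding B(3)[symmetric] by blast
  qed
qed

end


section \<open>Four-element algebras\<close>

lemma isomorphicI_converse:
  assumes A: "is_alg A" and B: "is_alg B" and g: "bij_betw g (carr B) (carr A)" "hom g B A"
  shows "isomorphic A B"
proof -
  define f where "f = inv_into (carr B) g"
  have f: "bij_betw f (carr A) (carr B)"
    unfolding f_def by (rule bij_betw_inv_into[OF g(1)])
  have fg: "f (g y) = y" if "y \<in> carr B" for y
    unfolding f_def using g(1) that by (rule bij_betw_inv_into_left)
  have surj: "\<exists>y\<in>carr B. x = g y" if "x \<in> carr A" for x
    using g(1) that by (auto simp: bij_betw_def)
  have g_ops: "zr A = g (zr B)" "on A = g (on B)" "\<And>x. x \<in> carr B \<Longrightarrow> ng A (g x) = g (ng B x)"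
    "\<And>x y. x \<in> carr B \<Longrightarrow> y \<in> carr B \<Longrightarrow> jn A (g x) (g y) = g (jn B x y)"
    "\<And>x y. x \<in> carr B \<Longrightarrow> y \<in> carr B \<Longrightarrow> mt A (g x) (g y) = g (mt B x y)"
    "\<And>x y. x \<in> carr B \<Longrightarrow> y \<in> carr B \<Longrightarrow> im A (g x) (g y) = g (im B x y)"
    using g(2) by (simp_all add: hom_def)
  have "f (zr A) = zr B" "f (on A) = on B"
    using B by (simp_all add: g_ops fg is_alg_def)
  moreover have "f (ng A x) = ng B (f x)" if "x \<in> carr A" for x
    using surj[OF that] B by (auto simp: g_ops fg is_alg_def)
  moreover have "f (jn A x y) = jn B (f x) (f y)" "f (mt A x y) = mt B (f x) (f y)"
      "f (im A x y) = im B (f x) (f y)" if "x \<in> carr A" "y \<in> carr A" for x y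
    using surj[OF that(1)] surj[OF that(2)] B by (auto simp: g_ops fg is_alg_def)
  ultimately show ?thesis
    using A B f by (auto simp: isomorphic_def)
qed

lemma is_alg_four_alg: "is_alg (four_alg i)"
  by (simp add: is_alg_def four_alg_def)

context DQD_algebra
begin

text \<open>Meeting with \<open>a\<close> and with \<open>b\<close> splits the implication into two implications on
  two-element chains, and there only the value at \<open>\<zero> \<leadsto> \<one>\<close> is free. The case \<open>\<zero> \<leadsto> \<one> = b\<close> is the
  last one with \<open>a\<close> and \<open>b\<close> exchanged.\<close>

lemma four_element_isomorphic:
  assumes ab: "a \<in> carr A" "b \<in> carr A" "carr A = {\<zero>, \<one>, a, b}"
    and compl: "a \<sqinter> b = \<zero>" "a \<squnion> b = \<one>" "a \<noteq> \<zero>" "b \<noteq> \<zero>"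
    and neg: "\<sim> a = a" "\<sim> b = b"
  shows "\<zero> \<leadsto> \<one> = \<zero> \<Longrightarrow> isomorphic A D1"
    and "\<zero> \<leadsto> \<one> = \<one> \<Longrightarrow> isomorphic A D2"
    and "\<zero> \<leadsto> \<one> = a \<Longrightarrow> isomorphic A D3"
proof -
  define g where "g p = (case p of E0 \<Rightarrow> \<zero> | E1 \<Rightarrow> \<one> | Ea \<Rightarrow> a | Eb \<Rightarrow> b)" for p
  have g_simps [simp]: "g E0 = \<zero>" "g E1 = \<one>" "g Ea = a" "g Eb = b"
    by (simp_all add: g_def)
  have compl' [simp]: "a \<sqinter> b = \<zero>" "b \<sqinter> a = \<zero>" "a \<squnion> b = \<one>" "b \<squnion> a = \<one>"
    using compl ab(1,2) by (simp_all add: meet_comm[of b a] join_comm[of b a])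
  have neq [simp]: "a \<noteq> b" "a \<noteq> \<one>" "b \<noteq> \<one>" "\<zero> \<noteq> \<one>" "b \<noteq> a" "\<one> \<noteq> a" "\<one> \<noteq> b" "\<one> \<noteq> \<zero>"
    using compl ab(1,2) bounds[of a] bounds[of b] by fastforce+
  have "inj g"
  proof (rule injI)
    show "p = q" if "g p = g q" for p q
      using that compl by (cases p; cases q) auto
  qed
  moreover have "range g = carr A"
  proof
    show "carr A \<subseteq> range g"
      unfolding ab(3) by (auto intro: range_eqI[of _ g E0] range_eqI[of _ g E1] range_eqI[of _ g Ea] range_eqI[of _ g Eb])
    show "range g \<subseteq> carr A"
      using ab(1,2) by (auto simp: g_def split: four.splits)
  qed
  ultimately have bij: "bij_betw g UNIV (carr A)"
    by (simp add: bij_betw_def)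
  \<comment> \<open>An element is determined by its meets with \<open>a\<close> and \<open>b\<close>.\<close>
  have imp_eq: "x \<leadsto> y = z \<longleftrightarrow> a \<sqinter> ((a \<sqinter> x) \<leadsto> (a \<sqinter> y)) = a \<sqinter> z \<and> b \<sqinter> ((b \<sqinter> x) \<leadsto> (b \<sqinter> y)) = b \<sqinter> z"
    if "x \<in> carr A" "y \<in> carr A" "z \<in> carr A" for x y z
    using that ab(1,2) eq_by_cover[of a b "x \<leadsto> y" z]
    by (auto simp: meet_imp_meet[symmetric])
  have zero_imp: "a \<sqinter> (\<zero> \<leadsto> a) = a \<sqinter> (\<zero> \<leadsto> \<one>)" "b \<sqinter> (\<zero> \<leadsto> b) = b \<sqinter> (\<zero> \<leadsto> \<one>)"
    using ab(1,2) meet_imp_meet[of a \<zero> \<one>] meet_imp_meet[of b \<zero> \<one>] by simp_all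
  have iso: "isomorphic A (four_alg i)" if "\<And>p q. g p \<leadsto> g q = g (i p q)" for i
  proof (rule isomorphicI_converse[OF alg is_alg_four_alg, of g])
    show "bij_betw g (carr (four_alg i)) (carr A)"
      using bij by (simp add: four_alg_def)
    have "g (four_join p q) = g p \<squnion> g q" "g (four_meet p q) = g p \<sqinter> g q" for p q
      using ab(1,2) by (cases p; cases q; simp)+
    moreover have "g (four_neg p) = \<sim> (g p)" for p
      using ab(1,2) neg by (cases p) auto
    ultimately show "hom g (four_alg i) A"
      by (simp add: hom_def four_alg_def that)
  qed
  show "isomorphic A D1" if "\<zero> \<leadsto> \<one> = \<zero>"
    unfolding D1_def
    by (rule iso, case_tac p; case_tac q) (use that ab(1,2) zero_imp in \<open>simp_all add: imp1_def imp_eq\<close>)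
  show "isomorphic A D2" if "\<zero> \<leadsto> \<one> = \<one>"
    unfolding D2_def
    by (rule iso, case_tac p; case_tac q) (use that ab(1,2) zero_imp in \<open>simp_all add: imp2_def imp_eq\<close>)
  show "isomorphic A D3" if "\<zero> \<leadsto> \<one> = a"
    unfolding D3_def
    by (rule iso, case_tac p; case_tac q) (use that ab(1,2) zero_imp in \<open>simp_all add: imp3_def imp_eq\<close>)
qed

end

context JID1_algebra
begin

lemma DSt_or_four_element:
  assumes top_or_le: "\<And>x. x \<in> carr A \<Longrightarrow> x = \<one> \<or> x \<sqsubseteq> \<sim> x"
  shows "A \<in> DSt \<or> isomorphic A D1 \<or> isomorphic A D2 \<or> isomorphic A D3"
proof -
  have tri: "x = \<one> \<or> \<sim> x = \<one> \<or> \<sim> x = x" if x: "x \<in> carr A" for x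
  proof (rule ccontr)
    assume no: "\<not> ?thesis"
    then have "\<sim> x \<sqsubseteq> \<sim> \<sim> x" "x \<sqsubseteq> \<sim> x"
      using top_or_le[of x] top_or_le[of "\<sim> x"] x by auto
    then have "\<sim> x \<sqinter> x = \<sim> x"
      using x neg_neg_meet[OF x] by (metis closed(3) meet_assoc)
    then show False
      using \<open>x \<sqsubseteq> \<sim> x\<close> no x meet_comm[of x "\<sim> x"] by auto
  qed
  show ?thesis
  proof (cases "\<exists>a\<in>carr A. \<sim> a = a \<and> a \<noteq> \<one>")
    case False
    have "\<sim> x \<sqinter> \<sim> \<sim> x = \<zero>" if "x \<in> carr A" for x
      using tri[OF that] False that by auto
    then have "A \<in> DSt"
      using in_DQD alg by (auto simp: DSt_def Mod_def)
    then show ?thesis ..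
  next
    case True
    then obtain a where a: "a \<in> carr A" "\<sim> a = a" "a \<noteq> \<one>" by blast
    define b where "b = a \<leadsto> \<zero>"
    have b: "b \<in> carr A" using a by (simp add: b_def)
    have ab: "a \<squnion> b = \<one>" "a \<sqinter> b = \<zero>"
      using a neg_join_star[of a] by (simp_all add: b_def)
    have a0: "a \<noteq> \<zero>" using a neg_bot by metis
    have b1: "b \<noteq> \<one>" using ab a a0 by auto
    have b0: "b \<noteq> \<zero>" using ab a by auto
    \<comment> \<open>If \<open>\<sim> b = \<one>\<close>, then double negation of \<open>a \<squnion> b = \<one>\<close> would give \<open>a = \<one>\<close>.\<close>
    have nb: "\<sim> b = b"
    proof -
      have "\<sim> \<sim> a \<squnion> \<sim> \<sim> b = \<one>"
        using a b neg_neg_join[of a b] by (simp add: ab)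
      then have "\<sim> b \<noteq> \<one>" using a b by auto
      then show ?thesis using tri[OF b] b1 by blast
    qed
    \<comment> \<open>Stated for \<open>c\<close>, \<open>d\<close> to be used for \<open>a\<close>, \<open>b\<close> in both orders. If \<open>\<sim> x = \<one>\<close>, the trichotomy for
      \<open>x \<squnion> d\<close> leaves only \<open>x \<squnion> d = d\<close>.\<close>
    have atom: "x = \<zero> \<or> x = c"
      if cd: "c \<in> carr A" "d \<in> carr A" "c \<sqinter> d = \<zero>" "c \<noteq> \<one>" "d \<noteq> \<one>" "d \<noteq> \<zero>" "\<sim> c = c" "\<sim> d = d"
        and x: "x \<in> carr A" "x \<sqsubseteq> c" for c d x
    proof -
      have "x \<noteq> \<one>" using x cd by auto
      then consider "\<sim> x = \<one>" | "\<sim> x = x" using tri x by blast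
      then show ?thesis
      proof cases
        case 1
        have nn: "\<sim> \<sim> (x \<squnion> d) = d"
          using x cd by (simp add: neg_neg_join 1)
        have "x \<squnion> d \<noteq> \<one>" "\<sim> (x \<squnion> d) \<noteq> \<one>"
          using nn cd by auto
        then have "\<sim> (x \<squnion> d) = x \<squnion> d"
          using tri[of "x \<squnion> d"] x cd by auto
        then have "x \<squnion> d = d" using nn by simp
        then have "x \<sqsubseteq> d" using x cd by (simp add: le_join_iff)
        then have "x = x \<sqinter> (c \<sqinter> d)"
          using x cd by (metis meet_assoc)
        then show ?thesis using x cd by simp
      next
        case 2
        have "x \<squnion> c = x"
          using neg_meet[of x c] x cd 2 by simp
        moreover have "x \<squnion> c = c" using x cd by (simp add: le_join_iff)
        ultimately show ?thesis by simp
      qed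
    qed
    have "x \<in> {\<zero>, \<one>, a, b}" if x: "x \<in> carr A" for x
    proof -
      have "x = (a \<sqinter> x) \<squnion> (b \<sqinter> x)"
        using a b x meet_join_distrib2[of x a b] by (simp add: ab)
      moreover have "a \<sqinter> x = \<zero> \<or> a \<sqinter> x = a"
        by (rule atom[of a b]) (use a b a0 b1 b0 ab nb x in \<open>simp_all add: meet_ac\<close>)
      moreover have "b \<sqinter> x = \<zero> \<or> b \<sqinter> x = b"
        by (rule atom[of b a]) (use a b a0 b1 b0 ab nb x in \<open>simp_all add: meet_ac\<close>)
      ultimately show ?thesis using a b ab by auto
    qed
    then have carr: "carr A = {\<zero>, \<one>, a, b}" using a b by auto
    then have carr': "carr A = {\<zero>, \<one>, b, a}" by auto
    have ba: "b \<squnion> a = \<one>" "b \<sqinter> a = \<zero>"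
      using a b ab by (simp_all add: join_comm[of b a] meet_comm[of b a])
    note iso = four_element_isomorphic[OF a(1) b carr ab(2,1) a0 b0 a(2) nb]
      four_element_isomorphic[OF b a(1) carr' ba(2,1) b0 a0 nb a(2)]
    have "\<zero> \<leadsto> \<one> \<in> {\<zero>, \<one>, a, b}"
      using closed(6)[OF closed(1,2)] carr by simp
    then show ?thesis
      using iso by blast
  qed
qed

end


section \<open>The join of the two subvarieties\<close>

text \<open>The identities that define \<open>JID1\<close>, collected to present it as a single class of models.\<close>

definition JID1_ids :: "identity set" where
  "JID1_ids = DQD_ids \<union> {
     vx\<^sup>\<sim> \<curlyvee> (vy \<rightharpoonup> vz) \<approx> (vx\<^sup>\<sim> \<curlyvee> vy) \<rightharpoonup> (vx\<^sup>\<sim> \<curlyvee> vz),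
     vx \<curlywedge> vx\<^sup>\<sim>\<^sup>\<star> \<approx> (vx \<curlywedge> vx\<^sup>\<sim>\<^sup>\<star>)\<^sup>\<sim>\<^sup>\<star>}"

lemma JID1_eq_Mod: "JID1 = Mod JID1_ids"
  by (auto simp: JID1_def JID_def DQD_def JID1_ids_def Mod_def simp del: holds.simps)

lemma four_algs_in_JID1: "D1 \<in> Mod JID1_ids" "D2 \<in> Mod JID1_ids" "D3 \<in> Mod JID1_ids"
proof -
  have pointwise: "four_alg i \<in> Mod E"
    if "\<And>v. \<forall>e\<in>E. case e of Eq s t \<Rightarrow> eval (four_alg i) v s = eval (four_alg i) v t" (is "\<And>v. ?P v") for i E
  proof -
    have "holds (four_alg i) e" if "e \<in> E" for e
      using \<open>\<And>v. ?P v\<close> \<open>e \<in> E\<close> by (cases e) fastforce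
    then show ?thesis using is_alg_four_alg by (simp add: Mod_def)
  qed
  show "D1 \<in> Mod JID1_ids"
    unfolding D1_def
    by (rule pointwise, simp add: JID1_ids_def DQD_ids_def semi_Heyting_ids_def bounded_lattice_ids_def four_alg_def,
        case_tac "v 0"; case_tac "v (Suc 0)"; case_tac "v 2"; simp add: imp1_def)
  show "D2 \<in> Mod JID1_ids"
    unfolding D2_def
    by (rule pointwise, simp add: JID1_ids_def DQD_ids_def semi_Heyting_ids_def bounded_lattice_ids_def four_alg_def,
        case_tac "v 0"; case_tac "v (Suc 0)"; case_tac "v 2"; simp add: imp2_def)
  show "D3 \<in> Mod JID1_ids"
    unfolding D3_def
    by (rule pointwise, simp add: JID1_ids_def DQD_ids_def semi_Heyting_ids_def bounded_lattice_ids_def four_alg_def,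
        case_tac "v 0"; case_tac "v (Suc 0)"; case_tac "v 2"; simp add: imp3_def)
qed

lemma (in DQD_algebra) JID1_if_DSt:
  assumes A: "A \<in> DSt"
  shows "A \<in> JID1"
proof -
  have "holds A (vx\<^sup>\<sim> \<curlywedge> vx\<^sup>\<sim>\<^sup>\<sim> \<approx> Zero)"
    using A by (simp add: DSt_def Mod_def del: holds.simps)
  from holds_elements[OF this]
  have meet: "\<sim> x \<sqinter> \<sim> \<sim> x = \<zero>" if "x \<in> carr A" for x
    using that by simp
  have join: "\<sim> x \<squnion> \<sim> \<sim> x = \<one>" if "x \<in> carr A" for x
    using that neg_meet[of "\<sim> x" "\<sim> \<sim> x"] meet[OF that]
    by (simp add: neg_neg_neg join_comm)
  have star: "\<sim> x \<leadsto> \<zero> = \<sim> \<sim> x" if "x \<in> carr A" for x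
    using that by (intro star_eqI) (simp_all add: meet join)
  have "\<sim> x \<squnion> (y \<leadsto> z) = (\<sim> x \<squnion> y) \<leadsto> (\<sim> x \<squnion> z)"
    if "x \<in> carr A" "y \<in> carr A" "z \<in> carr A" for x y z
    using that by (intro join_imp_complemented[of _ "\<sim> \<sim> x"]) (simp_all add: meet join)
  moreover have "x \<sqinter> (\<sim> x \<leadsto> \<zero>) = \<sim> (x \<sqinter> (\<sim> x \<leadsto> \<zero>)) \<leadsto> \<zero>" if "x \<in> carr A" for x
  proof -
    have "x \<sqinter> \<sim> \<sim> x = \<sim> \<sim> x"
      using that by (simp add: meet_comm[of x] neg_neg_meet)
    then show ?thesis using that by (simp add: star neg_neg_neg)
  qed
  ultimately show ?thesis
    using in_DQD alg by (auto simp: JID1_def JID_def Mod_def image_subset_iff)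
qed

lemma DSt_subset_JID1: "DSt \<subseteq> JID1"
  using DQD_algebra.JID1_if_DSt by (auto simp: DQD_algebra_def DSt_def)

theorem corollary5p10:
  assumes "infinite (UNIV :: 'a set)"
  shows "(JID1 :: 'a alg set) = join_in DQD DSt V_D1_D2_D3"
proof
  have variety_JID1: "variety (JID1 :: 'a alg set)"
    unfolding variety_def JID1_eq_Mod by blast
  have "{A :: 'a alg. isomorphic A D1 \<or> isomorphic A D2 \<or> isomorphic A D3} \<subseteq> JID1"
    unfolding JID1_eq_Mod using four_algs_in_JID1 Mod_isomorphic by blast
  then have "(V_D1_D2_D3 :: 'a alg set) \<subseteq> JID1"
    unfolding V_D1_D2_D3_def generated_variety_def using variety_JID1 by blast
  moreover have "(JID1 :: 'a alg set) \<subseteq> DQD"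
    by (auto simp: JID1_def JID_def)
  ultimately show "join_in DQD DSt V_D1_D2_D3 \<subseteq> (JID1 :: 'a alg set)"
    unfolding join_in_def subvarieties_def using variety_JID1 DSt_subset_JID1 by blast
next
  have "A \<in> X" if A: "A \<in> JID1" and X: "variety X" "DSt \<subseteq> X" "V_D1_D2_D3 \<subseteq> X"
    for A :: "'a alg" and X
  proof -
    interpret JID1_algebra A
      using A by unfold_locales (auto simp: JID1_def JID_def)
    from X(1) obtain E where E: "X = Mod E" by (auto simp: variety_def)
    have four: "B \<in> X" if "isomorphic B D1 \<or> isomorphic B D2 \<or> isomorphic B D3" for B
      using that X(3) unfolding V_D1_D2_D3_def generated_variety_def by blast
    have "holds A e" if "e \<in> E" for e
    proof (cases e)
      case (Eq s t)
      have "eval A v s = eval A v t" if v: "range v \<subseteq> carr A" for v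
      proof (rule ccontr)
        assume "eval A v s \<noteq> eval A v t"
        from separating_quotient[OF eval_closed[OF alg v] eval_closed[OF alg v] this]
        obtain B :: "'a alg" and h where B: "is_alg B" "hom h A B" "h ` carr A = carr B"
          and sep: "h (eval A v s) \<noteq> h (eval A v t)"
          and top_or_le: "\<And>x. x \<in> carr B \<Longrightarrow> x = on B \<or> mt B x (ng B x) = x"
          by metis
        have "B \<in> JID1"
          using Mod_hom_image[OF B(2,3,1)] A by (simp add: JID1_eq_Mod)
        then interpret B: JID1_algebra B
          by unfold_locales (auto simp: JID1_def JID_def)
        have "B \<in> X"
          using B.DSt_or_four_element[OF top_or_le] X(2) four by blast
        then have "holds B (s \<approx> t)"
          using E \<open>e \<in> E\<close> Eq by (auto simp: Mod_def simp del: holds.simps)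
        moreover have "range (h \<circ> v) \<subseteq> carr B"
          using v B(3) by auto
        ultimately show False
          using sep eval_hom[OF alg B(2) v] by simp
      qed
      then show ?thesis by (simp add: Eq)
    qed
    then show ?thesis using alg E by (simp add: Mod_def)
  qed
  then show "(JID1 :: 'a alg set) \<subseteq> join_in DQD DSt V_D1_D2_D3"
    unfolding join_in_def subvarieties_def by blast
qed

end
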